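(* Let $B$ be a locale. If $X$ and $Y$ are Hilbert $B$-modules and $X$ has a Hilbert basis, then any function $h:X\to Y$ is adjointable if and only if it is a homomorphism of $B$-modules.
   Context: A $B$-module is a complete lattice $X$ with an action $B\times X\to X$, $(b,x)\mapsto bx$, preserving arbitrary joins in each variable and satisfying $1x=x$ and $(b\wedge c)x=b(cx)$. A homomorphism of $B$-modules preserves arbitrary joins and the action. A pre-Hilbert $B$-module is a $B$-module $X$ with a function $\langle-,-\rangle:X\times X\to B$ (inner product) such that $\langle bx,y\rangle=b\wedge\langle x,y\rangle$, $\langle\bigvee_\alpha x_\alpha,y\rangle=\bigvee_\alpha\langle x_\alpha,y\rangle$ and $\langle x,y\rangle=\langle y,x\rangle$. It is a Hilbert $B$-module if moreover $\langle x,-\rangle=\langle y,-\rangle$ implies $x=y$ (non-degeneracy). A Hilbert basis of $X$ is a subset $\mathit{\Gamma}\subset X$ such that $x=\bigvee_{s\in\mathit{\Gamma}}\langle x,s\rangle s$ for all $x\in X$. A function $h:X\to Y$ between pre-Hilbert $B$-modules is adjointable if there is a function $h^\dagger:Y\to X$ such that $\langle h(x),y\rangle=\langle x,h^\dagger(y)\rangle$ for all $x\in X$, $y\in Y$. *)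

theory Defs
  imports Main
begin

(* The algebraic structure underlying a locale B (a frame): a complete lattice in which
   finite meets distribute over arbitrary joins. The library class
   complete_distrib_lattice is strictly stronger (complete distributivity). *)
class frame = complete_lattice +
  assumes inf_Sup_distrib: "inf b (Sup C) = (SUP c\<in>C. inf b c)"

(* Joins range over arbitrary sets, including the empty one, so the bottom element
   is preserved as well. *)
locale B_module =
  fixes act :: "'b::frame \<Rightarrow> 'x::complete_lattice \<Rightarrow> 'x"
  assumes act_Sup_left: "act (Sup C) x = (SUP b\<in>C. act b x)"
    and act_Sup_right: "act b (Sup S) = (SUP x\<in>S. act b x)"
    and act_top: "act top x = x"
    and act_inf: "act (inf b c) x = act b (act c x)"

definition B_module_hom ::
  "('b::frame \<Rightarrow> 'x::complete_lattice \<Rightarrow> 'x) \<Rightarrow> ('b \<Rightarrow> 'y::complete_lattice \<Rightarrow> 'y) \<Rightarrow> ('x \<Rightarrow> 'y) \<Rightarrow> bool"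
  where "B_module_hom actX actY h \<longleftrightarrow>
    (\<forall>S. h (Sup S) = (SUP x\<in>S. h x)) \<and> (\<forall>b x. h (actX b x) = actY b (h x))"

locale pre_Hilbert_module = B_module act
  for act :: "'b::frame \<Rightarrow> 'x::complete_lattice \<Rightarrow> 'x" +
  fixes ip :: "'x \<Rightarrow> 'x \<Rightarrow> 'b"
  assumes ip_act: "ip (act b x) y = inf b (ip x y)"
    and ip_Sup: "ip (Sup S) y = (SUP x\<in>S. ip x y)"
    and ip_commute: "ip x y = ip y x"

locale Hilbert_module = pre_Hilbert_module act ip
  for act :: "'b::frame \<Rightarrow> 'x::complete_lattice \<Rightarrow> 'x" and ip :: "'x \<Rightarrow> 'x \<Rightarrow> 'b" +
  assumes non_degenerate: "ip x = ip y \<Longrightarrow> x = y"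

definition Hilbert_basis ::
  "('b::frame \<Rightarrow> 'x::complete_lattice \<Rightarrow> 'x) \<Rightarrow> ('x \<Rightarrow> 'x \<Rightarrow> 'b) \<Rightarrow> 'x set \<Rightarrow> bool"
  where "Hilbert_basis act ip \<Gamma> \<longleftrightarrow> (\<forall>x. x = (SUP s\<in>\<Gamma>. act (ip x s) s))"

definition adjointable ::
  "('x \<Rightarrow> 'x \<Rightarrow> 'b) \<Rightarrow> ('y \<Rightarrow> 'y \<Rightarrow> 'b) \<Rightarrow> ('x \<Rightarrow> 'y) \<Rightarrow> bool"
  where "adjointable ipX ipY h \<longleftrightarrow> (\<exists>h' :: 'y \<Rightarrow> 'x. \<forall>x y. ipY (h x) y = ipX x (h' y))"

end

theory Submission
  imports Defs
begin

text \<open>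
  Non-degeneracy makes an adjointable map a homomorphism, since both sides of each required
  equation have the same inner products. Conversely, a homomorphism is determined by
  its values on a Hilbert basis, which forces its adjoint to be
  \<open>y \<mapsto> \<Squnion>\<^sub>s \<langle>h s, y\<rangle> s\<close>, with \<open>s\<close> ranging over the basis.
\<close>

lemma adjointable_imp_hom:
  assumes "pre_Hilbert_module actX ipX"
    and "Hilbert_module actY ipY"
    and "adjointable ipX ipY h"
  shows "B_module_hom actX actY h"
proof -
  interpret X: pre_Hilbert_module actX ipX by fact
  interpret Y: Hilbert_module actY ipY by fact
  obtain h' where adj: "\<And>x y. ipY (h x) y = ipX x (h' y)"
    using assms(3) unfolding adjointable_def by blast
  \<comment> \<open>Paired with any \<open>y\<close>, both sides become the join of
    \<open>ipX x (h' y)\<close> over \<open>S\<close>: \<open>adj\<close> moves \<open>h\<close>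
    across to \<open>h'\<close>, and each inner product preserves joins in its first
    argument.\<close>
  have "h (Sup S) = (SUP x\<in>S. h x)" for S
    by (rule Y.non_degenerate, rule ext) (simp add: adj X.ip_Sup Y.ip_Sup image_image)
  moreover have "h (actX b x) = actY b (h x)" for b x
    by (rule Y.non_degenerate, rule ext) (simp add: adj X.ip_act Y.ip_act)
  ultimately show ?thesis
    unfolding B_module_hom_def by blast
qed

lemma hom_imp_adjointable:
  assumes "pre_Hilbert_module actX ipX"
    and "pre_Hilbert_module actY ipY"
    and basis: "Hilbert_basis actX ipX \<Gamma>"
    and hom: "B_module_hom actX actY h"
  shows "adjointable ipX ipY h"
proof -
  interpret X: pre_Hilbert_module actX ipX by fact
  interpret Y: pre_Hilbert_module actY ipY by fact
  have h_Sup: "h (Sup S) = (SUP x\<in>S. h x)" and h_act: "h (actX b x) = actY b (h x)" for S b x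
    using hom unfolding B_module_hom_def by blast+
  \<comment> \<open>An adjoint must satisfy \<open>ipX (h' y) s = ipY (h s) y\<close>; these are the
    coefficients in the basis expansion of \<open>h' y\<close>.\<close>
  define h' where "h' y = (SUP s\<in>\<Gamma>. actX (ipY (h s) y) s)" for y
  have "ipY (h x) y = ipX x (h' y)" for x y
  proof -
    have "h x = h (SUP s\<in>\<Gamma>. actX (ipX x s) s)"
      using basis unfolding Hilbert_basis_def by metis
    also have "\<dots> = (SUP s\<in>\<Gamma>. actY (ipX x s) (h s))"
      by (simp add: h_Sup h_act image_image)
    finally have "ipY (h x) y = (SUP s\<in>\<Gamma>. inf (ipX x s) (ipY (h s) y))"
      by (simp add: Y.ip_Sup Y.ip_act image_image)
    \<comment> \<open>Symmetry puts \<open>s\<close> in the first slot, where the axioms let the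
      coefficients and the join be pulled inside \<open>ipX\<close>.\<close>
    also have "\<dots> = (SUP s\<in>\<Gamma>. inf (ipY (h s) y) (ipX s x))"
      by (simp add: inf_commute X.ip_commute[of x])
    also have "\<dots> = ipX (h' y) x"
      by (simp add: h'_def X.ip_Sup X.ip_act image_image)
    finally show ?thesis
      by (simp add: X.ip_commute[of x])
  qed
  then show ?thesis
    unfolding adjointable_def by blast
qed

theorem corollary4p4:
  fixes actX :: "'b::frame \<Rightarrow> 'x::complete_lattice \<Rightarrow> 'x"
    and ipX :: "'x \<Rightarrow> 'x \<Rightarrow> 'b"
    and actY :: "'b \<Rightarrow> 'y::complete_lattice \<Rightarrow> 'y"
    and ipY :: "'y \<Rightarrow> 'y \<Rightarrow> 'b"
    and h :: "'x \<Rightarrow> 'y"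
  assumes "Hilbert_module actX ipX"
    and "Hilbert_module actY ipY"
    and "\<exists>\<Gamma>. Hilbert_basis actX ipX \<Gamma>"
  shows "adjointable ipX ipY h \<longleftrightarrow> B_module_hom actX actY h"
  using assms adjointable_imp_hom hom_imp_adjointable Hilbert_module.axioms(1) by metis

end
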